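(* Let $n\ge 1$, let $M$ be an $n\times n$ complex Hermitian matrix, and write $M=A+iB$ with $A$ a real symmetric $n\times n$ matrix (the real part of $M$) and $B$ a real skew-symmetric $n\times n$ matrix (the imaginary part of $M$). For $\theta=(\theta_1,\dots,\theta_n)^T\in\mathbb{R}^n$ put $x=x(\theta)=[e^{i\theta_1},e^{i\theta_2},\dots,e^{i\theta_n}]^T\in\mathbb{C}^n$. Then the second-order Taylor approximation (second-order Taylor polynomial at $\theta=0$) of the function $\theta\mapsto x(\theta)^H M\,x(\theta)$ is $$\sum_{k,l=1}^n M_{kl}+\theta^T L(A)\,\theta+f(B)^T\theta .$$
   Context: Here $i$ in $e^{i\theta_k}$ and $A+iB$ is the imaginary unit and $x^H$ is the conjugate transpose of $x$. The linear map $L:\mathbb{R}^{n\times n}\to\mathbb{R}^{n\times n}$ is defined by $(L(A))_{kk}=A_{kk}-\sum_{j=1}^n A_{kj}$ and $(L(A))_{kl}=A_{kl}$ for $k\ne l$. The linear map $f:\mathbb{R}^{n\times n}\to\mathbb{R}^n$ is defined by $(f(A))_k=2\sum_{j=1}^n A_{kj}$. *)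

theory Defs
  imports "HOL-Analysis.Analysis"
begin

definition conj_transpose :: "complex^'n^'m \<Rightarrow> complex^'m^'n" where
  "conj_transpose M = (\<chi> k l. cnj (M $ l $ k))"

definition hermitian :: "complex^'n^'n \<Rightarrow> bool" where
  "hermitian M \<longleftrightarrow> conj_transpose M = M"

text \<open>The scalar \<open>x\<^sup>H M x\<close>; it stays complex-valued, also for Hermitian \<open>M\<close>.\<close>

definition quad_form :: "complex^'n^'n \<Rightarrow> complex^'n \<Rightarrow> complex" where
  "quad_form M x = (\<Sum>k\<in>UNIV. cnj (x $ k) * (M *v x) $ k)"

definition phase_vec :: "real^'n \<Rightarrow> complex^'n" where
  "phase_vec \<theta> = (\<chi> k. exp (\<i> * of_real (\<theta> $ k)))"

definition L_map :: "real^'n^'n \<Rightarrow> real^'n^'n" where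
  "L_map A = (\<chi> k l. if k = l then A $ k $ k - (\<Sum>j\<in>UNIV. A $ k $ j) else A $ k $ l)"

definition f_map :: "real^'n^'n \<Rightarrow> real^'n" where
  "f_map A = (\<chi> k. 2 * (\<Sum>j\<in>UNIV. A $ k $ j))"

text \<open>
  \<open>P\<close> is the second-order Taylor polynomial of \<open>g\<close> at \<open>a\<close>: \<open>g\<close> is Frechet differentiable near
  \<open>a\<close> and twice Frechet differentiable at \<open>a\<close>, and
  \<open>P(x) = g(a) + Dg(a)(x - a) + 1/2 D\<^sup>2g(a)(x - a, x - a)\<close>.
  Being a relation, it asserts the existence of the derivatives.
\<close>

definition second_order_taylor ::
  "('a::real_normed_vector \<Rightarrow> 'b::real_normed_vector) \<Rightarrow> 'a \<Rightarrow> ('a \<Rightarrow> 'b) \<Rightarrow> bool" where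
  "second_order_taylor g a P \<longleftrightarrow>
     (\<exists>(g' :: 'a \<Rightarrow> 'a \<Rightarrow>\<^sub>L 'b) (g'' :: 'a \<Rightarrow>\<^sub>L 'a \<Rightarrow>\<^sub>L 'b).
        (\<forall>\<^sub>F y in nhds a. (g has_derivative blinfun_apply (g' y)) (at y)) \<and>
        (g' has_derivative blinfun_apply g'') (at a) \<and>
        (\<forall>x. P x = g a + blinfun_apply (g' a) (x - a)
                   + (1/2) *\<^sub>R blinfun_apply (blinfun_apply g'' (x - a)) (x - a)))"

lemma second_order_taylor_unique:
  assumes "second_order_taylor g a P" and "second_order_taylor g a Q"
  shows "P = Q"
proof -
  obtain p' p'' where p: "\<forall>\<^sub>F y in nhds a. (g has_derivative blinfun_apply (p' y)) (at y)"
      "(p' has_derivative blinfun_apply p'') (at a)"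
      "\<And>x. P x = g a + p' a (x - a) + (1/2) *\<^sub>R p'' (x - a) (x - a)"
    using assms(1) unfolding second_order_taylor_def by blast
  obtain q' q'' where q: "\<forall>\<^sub>F y in nhds a. (g has_derivative blinfun_apply (q' y)) (at y)"
      "(q' has_derivative blinfun_apply q'') (at a)"
      "\<And>x. Q x = g a + q' a (x - a) + (1/2) *\<^sub>R q'' (x - a) (x - a)"
    using assms(2) unfolding second_order_taylor_def by blast
  have ev: "\<forall>\<^sub>F y in nhds a. p' y = q' y"
    using p(1) q(1)
    by eventually_elim (metis blinfun_apply_inject has_derivative_unique)
  then have a: "p' a = q' a"
    by (rule eventually_nhds_x_imp_x)
  have "\<forall>\<^sub>F y in at a. p' y = q' y"
    using ev by (simp add: eventually_at_filter eventually_mono)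
  then have "(q' has_derivative blinfun_apply p'') (at a)"
    using has_derivative_transform_eventually[OF p(2)] a by blast
  then have "p'' = q''"
    using q(2) by (metis blinfun_apply_inject has_derivative_unique)
  with a p(3) q(3) show ?thesis by auto
qed

end

theory Submission
  imports Defs
begin

text \<open>
  Expanding, \<open>x\<^sup>H M x = (\<Sum>k l. M\<^sub>k\<^sub>l exp (\<i> (\<theta>\<^sub>l - \<theta>\<^sub>k)))\<close>, and the exponential
  of a linear form \<open>\<Phi>\<close> has Taylor polynomial \<open>1 + \<Phi> + \<Phi>\<^sup>2 / 2\<close>.  In the resulting double sum
  the terms of \<open>A\<close> of first order and those of \<open>B\<close> of second order cancel under exchanging \<open>k\<close>
  and \<open>l\<close>.
\<close>

lemma second_order_taylor_const:
  "second_order_taylor (\<lambda>_. c) a (\<lambda>_. c)"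
  unfolding second_order_taylor_def
  by (rule exI[where x = "\<lambda>_. 0"], rule exI[where x = 0]) (simp add: zero_blinfun.rep_eq)

lemma second_order_taylor_add:
  assumes "second_order_taylor g a P" and "second_order_taylor h a Q"
  shows "second_order_taylor (\<lambda>x. g x + h x) a (\<lambda>x. P x + Q x)"
proof -
  obtain p' p'' where p: "\<forall>\<^sub>F y in nhds a. (g has_derivative blinfun_apply (p' y)) (at y)"
      "(p' has_derivative blinfun_apply p'') (at a)"
      "\<And>x. P x = g a + p' a (x - a) + (1/2) *\<^sub>R p'' (x - a) (x - a)"
    using assms(1) unfolding second_order_taylor_def by blast
  obtain q' q'' where q: "\<forall>\<^sub>F y in nhds a. (h has_derivative blinfun_apply (q' y)) (at y)"
      "(q' has_derivative blinfun_apply q'') (at a)"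
      "\<And>x. Q x = h a + q' a (x - a) + (1/2) *\<^sub>R q'' (x - a) (x - a)"
    using assms(2) unfolding second_order_taylor_def by blast
  have "\<forall>\<^sub>F y in nhds a. ((\<lambda>x. g x + h x) has_derivative blinfun_apply (p' y + q' y)) (at y)"
    using p(1) q(1)
    by eventually_elim (auto simp: plus_blinfun.rep_eq intro: has_derivative_add)
  moreover have "((\<lambda>y. p' y + q' y) has_derivative blinfun_apply (p'' + q'')) (at a)"
    using has_derivative_add[OF p(2) q(2)] by (simp add: plus_blinfun.rep_eq)
  ultimately show ?thesis
    unfolding second_order_taylor_def
    by (intro exI[where x = "\<lambda>y. p' y + q' y"] exI[where x = "p'' + q''"])
      (simp add: p(3) q(3) plus_blinfun.rep_eq algebra_simps)
qed

lemma second_order_taylor_sum: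
  assumes "\<And>i. i \<in> I \<Longrightarrow> second_order_taylor (g i) a (P i)"
  shows "second_order_taylor (\<lambda>x. \<Sum>i\<in>I. g i x) a (\<lambda>x. \<Sum>i\<in>I. P i x)"
  using assms
  \<comment> \<open>For infinite \<open>I\<close> both sums are 0 by default, so this case, like the
    empty one, is covered by the constant map.\<close>
  by (induction I rule: infinite_finite_induct)
    (auto intro: second_order_taylor_const second_order_taylor_add)

text \<open>Differentiating multiplies the function by \<Phi>: the derivative at y is h -> c * exp
  (\<Phi> y) * \<Phi> h. It therefore depends linearly on the value at y, and one computation of the
  derivative serves for both orders.\<close>

lemma second_order_taylor_cmult_exp:
  fixes \<Phi> :: "'a::real_normed_vector \<Rightarrow> 'b::{banach, real_normed_field}"
  assumes "bounded_linear \<Phi>"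
  shows "second_order_taylor (\<lambda>x. c * exp (\<Phi> x)) a
           (\<lambda>x. c * exp (\<Phi> a) * (1 + \<Phi> (x - a) + (1/2) *\<^sub>R (\<Phi> (x - a))\<^sup>2))"
proof -
  define F where "F = Blinfun \<Phi>"
  have F: "blinfun_apply F = \<Phi>"
    unfolding F_def by (rule bounded_linear_Blinfun_apply[OF assms])
  \<comment> \<open>\<open>T z\<close> is the functional h -> z * \<Phi> h. The derivative map is
    then \<open>T\<close> after the function itself, and a bounded linear \<open>T\<close> passes
    through the second differentiation.\<close>
  define T where "T z = blinfun_mult_right z o\<^sub>L F" for z :: 'b
  have T: "bounded_linear T"
    unfolding T_def
    by (intro bounded_bilinear.bounded_linear_left[OF bounded_bilinear_blinfun_compose,
          THEN bounded_linear_compose] bounded_linear_blinfun_mult_right)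
  have apply_T: "blinfun_apply (T z) = (\<lambda>h. z * \<Phi> h)" for z
    by (simp add: T_def F fun_eq_iff)
  have deriv: "((\<lambda>x. c * exp (\<Phi> x)) has_derivative (\<lambda>h. c * exp (\<Phi> y) * \<Phi> h)) (at y)" for y
    using has_derivative_mult_right[OF has_derivative_compose[OF
          bounded_linear_imp_has_derivative[OF assms]
          DERIV_exp[unfolded has_field_derivative_def]], of c]
    by (simp add: mult.assoc)
  define g'' where "g'' = Blinfun (\<lambda>h. T (c * exp (\<Phi> a) * \<Phi> h))"
  have g'': "blinfun_apply g'' = (\<lambda>h. T (c * exp (\<Phi> a) * \<Phi> h))"
    unfolding g''_def
    by (intro bounded_linear_Blinfun_apply bounded_linear_compose[OF T]
        bounded_linear_const_mult assms)
  have "((\<lambda>y. T (c * exp (\<Phi> y))) has_derivative blinfun_apply g'') (at a)"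
    unfolding g'' by (rule bounded_linear.has_derivative[OF T deriv])
  moreover have "((\<lambda>x. c * exp (\<Phi> x)) has_derivative blinfun_apply (T (c * exp (\<Phi> y)))) (at y)"
    for y unfolding apply_T by (rule deriv)
  ultimately show ?thesis
    unfolding second_order_taylor_def
    by (intro exI[where x = "\<lambda>y. T (c * exp (\<Phi> y))"] exI[where x = g''])
      (simp add: g'' apply_T power2_eq_square algebra_simps)
qed

lemma quad_form_phase_vec:
  "quad_form M (phase_vec \<theta>) =
     (\<Sum>k\<in>UNIV. \<Sum>l\<in>UNIV. M $ k $ l * exp (\<i> * complex_of_real (\<theta> $ l - \<theta> $ k)))"
proof -
  have "exp (\<i> * complex_of_real (\<theta> $ l - \<theta> $ k)) =
      cnj (phase_vec \<theta> $ k) * phase_vec \<theta> $ l" for k l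
    by (simp add: phase_vec_def exp_cnj right_diff_distrib flip: exp_add)
  then show ?thesis
    by (simp add: quad_form_def matrix_vector_mult_def sum_distrib_left mult_ac)
qed

text \<open>Both indices run over the same set, so exchanging the two sums shows that the value
  equals its own negative.\<close>

lemma sum_sum_antisym_eq_0:
  fixes c :: "'i \<Rightarrow> 'i \<Rightarrow> real"
  assumes "\<And>k l. c k l = - c l k"
  shows "(\<Sum>k\<in>I. \<Sum>l\<in>I. c k l) = 0"
proof -
  have "(\<Sum>k\<in>I. \<Sum>l\<in>I. c k l) = (\<Sum>k\<in>I. \<Sum>l\<in>I. - c l k)"
    by (intro sum.cong refl assms)
  also have "\<dots> = - (\<Sum>k\<in>I. \<Sum>l\<in>I. c k l)"
    by (subst sum.swap) (simp add: sum_negf)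
  finally show ?thesis by simp
qed

lemma transpose_eq_self_nth:
  assumes "transpose A = A"
  shows "A $ k $ l = A $ l $ k"
  using assms by (metis transpose_def vec_lambda_beta)

lemma transpose_eq_uminus_nth:
  assumes "transpose B = - B"
  shows "B $ k $ l = - B $ l $ k"
  using arg_cong[OF assms, of "\<lambda>X. X $ l $ k"] by (simp add: transpose_def)

text \<open>\<open>L_map A\<close> is A minus the diagonal matrix of its row sums, the negative of
  the Laplacian of the graph with edge weights A. Its quadratic form is thus minus the Dirichlet
  energy; the 1/2 is there because ordered pairs count every edge twice.\<close>

lemma inner_L_map:
  fixes A :: "real^'n^'n"
  assumes "transpose A = A"
  shows "\<theta> \<bullet> (L_map A *v \<theta>) =
           - (\<Sum>k\<in>UNIV. \<Sum>l\<in>UNIV. A $ k $ l * (\<theta> $ l - \<theta> $ k)\<^sup>2) / 2"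
proof -
  \<comment> \<open>The rows of \<open>L_map A\<close> sum to 0, so only differences of the entries
    of \<theta> enter.\<close>
  have row: "(L_map A *v \<theta>) $ k = (\<Sum>l\<in>UNIV. A $ k $ l * (\<theta> $ l - \<theta> $ k))" for k
  proof -
    have "(L_map A *v \<theta>) $ k =
        (\<Sum>l\<in>UNIV. A $ k $ l * \<theta> $ l - (if l = k then (\<Sum>j\<in>UNIV. A $ k $ j) * \<theta> $ k else 0))"
      unfolding matrix_vector_mult_def L_map_def
      by (auto intro!: sum.cong simp: algebra_simps)
    then show ?thesis
      by (simp add: sum_subtractf sum_distrib_right right_diff_distrib)
  qed
  define S where "S = (\<Sum>k\<in>UNIV. \<Sum>l\<in>UNIV. \<theta> $ k * (A $ k $ l * (\<theta> $ l - \<theta> $ k)))"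
  have S: "\<theta> \<bullet> (L_map A *v \<theta>) = S"
    by (simp add: S_def inner_vec_def row sum_distrib_left)
  \<comment> \<open>A difference of squares is antisymmetric, hence vanishes against the symmetric
    A. It is also twice the summand of \<open>S\<close> plus the energy term, which ties the two
    sums together.\<close>
  have "(\<Sum>k\<in>UNIV. \<Sum>l\<in>UNIV. A $ k $ l * ((\<theta> $ l)\<^sup>2 - (\<theta> $ k)\<^sup>2)) = 0"
  proof (rule sum_sum_antisym_eq_0)
    show "A $ k $ l * ((\<theta> $ l)\<^sup>2 - (\<theta> $ k)\<^sup>2) = - (A $ l $ k * ((\<theta> $ k)\<^sup>2 - (\<theta> $ l)\<^sup>2))" for k l
      by (simp add: transpose_eq_self_nth[OF assms, of l k] algebra_simps)
  qed
  moreover have "A $ k $ l * ((\<theta> $ l)\<^sup>2 - (\<theta> $ k)\<^sup>2) =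
      2 * (\<theta> $ k * (A $ k $ l * (\<theta> $ l - \<theta> $ k))) + A $ k $ l * (\<theta> $ l - \<theta> $ k)\<^sup>2" for k l
    by (simp add: power2_eq_square algebra_simps)
  ultimately have "2 * S + (\<Sum>k\<in>UNIV. \<Sum>l\<in>UNIV. A $ k $ l * (\<theta> $ l - \<theta> $ k)\<^sup>2) = 0"
    by (simp only: S_def sum.distrib sum_distrib_left)
  then show ?thesis
    unfolding S by simp
qed

text \<open>The symmetric factor \<theta>_l + \<theta>_k vanishes against the skew B, and \<theta>_l
  - \<theta>_k differs from it by 2 \<theta>_k. This is the origin of the factor 2 in
  \<open>f_map\<close>.\<close>

lemma inner_f_map:
  fixes B :: "real^'n^'n"
  assumes "transpose B = - B"
  shows "f_map B \<bullet> \<theta> = - (\<Sum>k\<in>UNIV. \<Sum>l\<in>UNIV. B $ k $ l * (\<theta> $ l - \<theta> $ k))"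
proof -
  have "(\<Sum>k\<in>UNIV. \<Sum>l\<in>UNIV. B $ k $ l * (\<theta> $ l + \<theta> $ k)) = 0"
  proof (rule sum_sum_antisym_eq_0)
    show "B $ k $ l * (\<theta> $ l + \<theta> $ k) = - (B $ l $ k * (\<theta> $ k + \<theta> $ l))" for k l
      by (simp add: transpose_eq_uminus_nth[OF assms, of l k] algebra_simps)
  qed
  moreover have "B $ k $ l * (\<theta> $ l + \<theta> $ k) =
      2 * (B $ k $ l * \<theta> $ k) + B $ k $ l * (\<theta> $ l - \<theta> $ k)" for k l
    by (simp add: algebra_simps)
  moreover have "f_map B \<bullet> \<theta> = 2 * (\<Sum>k\<in>UNIV. \<Sum>l\<in>UNIV. B $ k $ l * \<theta> $ k)"
    by (simp add: inner_vec_def f_map_def sum_distrib_left sum_distrib_right mult.assoc)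
  ultimately show ?thesis
    by (simp add: sum.distrib sum_distrib_left)
qed

theorem lemma1:
  fixes M :: "complex^'n^'n" and A B :: "real^'n^'n"
  assumes "hermitian M"
    and "\<And>k l. M $ k $ l = complex_of_real (A $ k $ l) + \<i> * complex_of_real (B $ k $ l)"
    and "transpose A = A"
    and "transpose B = - B"
  shows "second_order_taylor
           (\<lambda>\<theta> :: real^'n. quad_form M (phase_vec \<theta>)) 0
           (\<lambda>\<theta>. (\<Sum>k\<in>UNIV. \<Sum>l\<in>UNIV. M $ k $ l)
                + complex_of_real (\<theta> \<bullet> (L_map A *v \<theta>))
                + complex_of_real (f_map B \<bullet> \<theta>))"
proof -
  \<comment> \<open>\<open>d\<close> is antisymmetric in k and l and its square is symmetric; hence
    \<open>A0\<close> and \<open>B0\<close> below.\<close>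
  define d where "d \<theta> k l = \<theta> $ l - \<theta> $ k" for \<theta> :: "real^'n" and k l
  have lin: "bounded_linear (\<lambda>\<theta>. \<i> * complex_of_real (d \<theta> k l))" for k l
    unfolding d_def
    by (intro bounded_linear_const_mult bounded_linear_compose[OF bounded_linear_of_real]
        bounded_linear_sub bounded_linear_vec_nth)
  have A0: "(\<Sum>k\<in>UNIV. \<Sum>l\<in>UNIV. A $ k $ l * d \<theta> k l) = 0" for \<theta>
  proof (rule sum_sum_antisym_eq_0)
    show "A $ k $ l * d \<theta> k l = - (A $ l $ k * d \<theta> l k)" for k l
      by (simp add: transpose_eq_self_nth[OF assms(3), of l k] d_def algebra_simps)
  qed
  have B0: "(\<Sum>k\<in>UNIV. \<Sum>l\<in>UNIV. B $ k $ l * (d \<theta> k l)\<^sup>2) = 0" for \<theta>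
  proof (rule sum_sum_antisym_eq_0)
    show "B $ k $ l * (d \<theta> k l)\<^sup>2 = - (B $ l $ k * (d \<theta> l k)\<^sup>2)" for k l
      by (simp add: transpose_eq_uminus_nth[OF assms(4), of l k] d_def power2_commute)
  qed
  have "second_order_taylor (\<lambda>\<theta>. quad_form M (phase_vec \<theta>)) 0
      (\<lambda>\<theta>. \<Sum>k\<in>UNIV. \<Sum>l\<in>UNIV. M $ k $ l * exp (\<i> * complex_of_real (d 0 k l)) *
        (1 + \<i> * complex_of_real (d (\<theta> - 0) k l) +
          (1/2) *\<^sub>R (\<i> * complex_of_real (d (\<theta> - 0) k l))\<^sup>2))"
    unfolding quad_form_phase_vec d_def[symmetric]
    by (intro second_order_taylor_sum second_order_taylor_cmult_exp lin)
  moreover have "(\<Sum>k\<in>UNIV. \<Sum>l\<in>UNIV. M $ k $ l * exp (\<i> * complex_of_real (d 0 k l)) *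
        (1 + \<i> * complex_of_real (d (\<theta> - 0) k l) +
          (1/2) *\<^sub>R (\<i> * complex_of_real (d (\<theta> - 0) k l))\<^sup>2))
      = (\<Sum>k\<in>UNIV. \<Sum>l\<in>UNIV. M $ k $ l)
        + complex_of_real (\<theta> \<bullet> (L_map A *v \<theta>)) + complex_of_real (f_map B \<bullet> \<theta>)"
    (is "?lhs = ?rhs") for \<theta>
  proof -
    \<comment> \<open>All phase differences vanish at the centre 0, so each exponential factor is 1.
      With M = A + iB, the first-order factor i d turns B into the real term -B d, and (i d)^2 =
      -d^2 gives the second-order terms.\<close>
    have "?lhs = (\<Sum>k\<in>UNIV. \<Sum>l\<in>UNIV. M $ k $ l
        + \<i> * complex_of_real (A $ k $ l * d \<theta> k l) - complex_of_real (B $ k $ l * d \<theta> k l)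
        - complex_of_real (A $ k $ l * (d \<theta> k l)\<^sup>2) / 2
        - \<i> * complex_of_real (B $ k $ l * (d \<theta> k l)\<^sup>2) / 2)"
      by (intro sum.cong refl)
        (simp add: assms(2) d_def[of 0] complex_eq_iff power2_eq_square algebra_simps)
    also have "\<dots> = (\<Sum>k\<in>UNIV. \<Sum>l\<in>UNIV. M $ k $ l)
        + \<i> * complex_of_real (\<Sum>k\<in>UNIV. \<Sum>l\<in>UNIV. A $ k $ l * d \<theta> k l)
        - complex_of_real (\<Sum>k\<in>UNIV. \<Sum>l\<in>UNIV. B $ k $ l * d \<theta> k l)
        - complex_of_real (\<Sum>k\<in>UNIV. \<Sum>l\<in>UNIV. A $ k $ l * (d \<theta> k l)\<^sup>2) / 2
        - \<i> * complex_of_real (\<Sum>k\<in>UNIV. \<Sum>l\<in>UNIV. B $ k $ l * (d \<theta> k l)\<^sup>2) / 2"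
      by (simp only: sum.distrib sum_subtractf of_real_sum sum_distrib_left sum_divide_distrib)
    \<comment> \<open>\<open>A0\<close> and \<open>B0\<close> remove both imaginary sums; the two
      real sums left are the linear form of \<open>f_map B\<close> and the quadratic form of
      \<open>L_map A\<close>.\<close>
    also have "\<dots> = ?rhs"
      unfolding A0 B0 inner_L_map[OF assms(3), folded d_def]
        inner_f_map[OF assms(4), folded d_def] by simp
    finally show ?thesis .
  qed
  ultimately show ?thesis by simp
qed

end
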